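(* Let $\mathcal{M}_1,\mathcal{M}_2$ be finite metric spaces. If $f:\mathcal{M}_1\to\mathcal{M}_2$ is a $(t_1,t_2,m_1,m_2)$-biometric embedding and $(\mathsf{Gen}(\cdot),\mathsf{Rep}(\cdot,\cdot))$ is an $(\mathcal{M}_2,m_2,\ell,t_2,\epsilon)$-fuzzy extractor, then $(\mathsf{Gen}(f(\cdot)),\mathsf{Rep}(f(\cdot),\cdot))$ is an $(\mathcal{M}_1,m_1,\ell,t_1,\epsilon)$-fuzzy extractor.
   Context: Min-entropy: $\mathbf{H}_\infty(A)=-\log_2\max_a\Pr[A=a]$. Statistical distance: $\mathbf{SD}(A,B)=\frac12\sum_v|\Pr(A=v)-\Pr(B=v)|$. $U_\ell$ is uniform on $\{0,1\}^\ell$. $\mathsf{dis}_i$ is the distance on $\mathcal{M}_i$. A function $f:\mathcal{M}_1\to\mathcal{M}_2$ is a $(t_1,t_2,m_1,m_2)$-biometric embedding if (i) for all $w_1,w_1'\in\mathcal{M}_1$ with $\mathsf{dis}_1(w_1,w_1')\le t_1$ we have $\mathsf{dis}_2(f(w_1),f(w_1'))\le t_2$; and (ii) for every distribution $W_1$ on $\mathcal{M}_1$ of min-entropy at least $m_1$, $f(W_1)$ has min-entropy at least $m_2$. An $(\mathcal{M},m,\ell,t,\epsilon)$-fuzzy extractor is a pair of randomized procedures: $\mathsf{Gen}$ maps $w\in\mathcal{M}$ to $(R,P)$ with $R\in\{0,1\}^\ell$, $P\in\{0,1\}^*$; $\mathsf{Rep}$ takes $w'\in\mathcal{M}$ and $P$;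 correctness: if $\mathsf{dis}(w,w')\le t$ and $(R,P)\leftarrow\mathsf{Gen}(w)$ then $\mathsf{Rep}(w',P)=R$; security: for every distribution $W$ on $\mathcal{M}$ of min-entropy at least $m$, if $(R,P)\leftarrow\mathsf{Gen}(W)$ then $\mathbf{SD}((R,P),(U_\ell,P))\le\epsilon$. *)

theory Defs
  imports "HOL-Probability.Probability"
begin

(* The supremum is a maximum; for a finitely supported A see min_entropy_Max. *)
definition min_entropy :: "'a pmf \<Rightarrow> real" where
  "min_entropy A = - log 2 (SUP a. pmf A a)"

definition statistical_distance :: "'a pmf \<Rightarrow> 'a pmf \<Rightarrow> real" where
  "statistical_distance A B = (\<Sum>\<^sub>\<infinity>v. \<bar>pmf A v - pmf B v\<bar>) / 2"

definition uniform_bits :: "nat \<Rightarrow> bool list pmf" where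
  "uniform_bits l = pmf_of_set {r. length r = l}"

definition biometric_embedding ::
  "'a set \<Rightarrow> ('a \<Rightarrow> 'a \<Rightarrow> real) \<Rightarrow> 'b set \<Rightarrow> ('b \<Rightarrow> 'b \<Rightarrow> real) \<Rightarrow>
   real \<Rightarrow> real \<Rightarrow> real \<Rightarrow> real \<Rightarrow> ('a \<Rightarrow> 'b) \<Rightarrow> bool" where
  "biometric_embedding M1 dis1 M2 dis2 t1 t2 m1 m2 f \<longleftrightarrow>
     f \<in> M1 \<rightarrow> M2 \<and>
     (\<forall>w\<in>M1. \<forall>w'\<in>M1. dis1 w w' \<le> t1 \<longrightarrow> dis2 (f w) (f w') \<le> t2) \<and>
     (\<forall>W. set_pmf W \<subseteq> M1 \<longrightarrow> min_entropy W \<ge> m1 \<longrightarrow> min_entropy (map_pmf f W) \<ge> m2)"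

(* Randomized procedures are functions into distributions. Correctness is perfect: it is required
   for every (R, P) that Gen w outputs with positive probability, and Rep must then return R with
   probability 1 over its own coins. In the security condition, the second argument of the
   statistical distance is (U, P) with P distributed as in (R, P) and U uniform and independent
   of P. *)
definition fuzzy_extractor ::
  "'a set \<Rightarrow> ('a \<Rightarrow> 'a \<Rightarrow> real) \<Rightarrow> real \<Rightarrow> nat \<Rightarrow> real \<Rightarrow> real \<Rightarrow>
   ('a \<Rightarrow> (bool list \<times> bool list) pmf) \<Rightarrow> ('a \<Rightarrow> bool list \<Rightarrow> bool list pmf) \<Rightarrow> bool" where
  "fuzzy_extractor M dis m l t \<epsilon> Gen Rep \<longleftrightarrow>
     (\<forall>w\<in>M. \<forall>(R, P)\<in>set_pmf (Gen w). length R = l) \<and>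
     (\<forall>w\<in>M. \<forall>w'\<in>M. dis w w' \<le> t \<longrightarrow>
        (\<forall>(R, P)\<in>set_pmf (Gen w). pmf (Rep w' P) R = 1)) \<and>
     (\<forall>W. set_pmf W \<subseteq> M \<longrightarrow> min_entropy W \<ge> m \<longrightarrow>
        (let RP = bind_pmf W Gen
         in statistical_distance RP (pair_pmf (uniform_bits l) (map_pmf snd RP)) \<le> \<epsilon>))"

lemma min_entropy_Max:
  assumes "finite (set_pmf A)"
  shows "min_entropy A = - log 2 (Max (pmf A ` set_pmf A))"
proof -
  let ?m = "Max (pmf A ` set_pmf A)"
  have fin: "finite (pmf A ` set_pmf A)" and ne: "pmf A ` set_pmf A \<noteq> {}"
    using assms set_pmf_not_empty by auto
  have "(SUP a. pmf A a) = ?m"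
  proof (rule cSup_eq_maximum)
    show "?m \<in> range (pmf A)"
      using Max_in[OF fin ne] by auto
    fix x assume "x \<in> range (pmf A)"
    then obtain a where x: "x = pmf A a" by auto
    show "x \<le> ?m"
    proof (cases "a \<in> set_pmf A")
      case True
      then show ?thesis using fin x by simp
    next
      case False
      then have "x = 0" using x by (simp add: set_pmf_iff)
      moreover have "0 \<le> ?m" using Max_in[OF fin ne] by auto
      ultimately show ?thesis by simp
    qed
  qed
  then show ?thesis by (simp add: min_entropy_def)
qed

lemma statistical_distance_summable:
  "(\<lambda>v. \<bar>pmf A v - pmf B v\<bar>) summable_on UNIV"
proof -
  have "integrable (count_space UNIV) (\<lambda>v. \<bar>pmf A v - pmf B v\<bar>)"
    by (intro integrable_abs Bochner_Integration.integrable_diff integrable_pmf)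
  then have "Infinite_Set_Sum.abs_summable_on (\<lambda>v. \<bar>pmf A v - pmf B v\<bar>) UNIV"
    by (simp add: Infinite_Set_Sum.abs_summable_on_def)
  then have "Infinite_Sum.abs_summable_on (\<lambda>v. \<bar>pmf A v - pmf B v\<bar>) UNIV"
    by (simp only: abs_summable_equivalent)
  then show ?thesis by (rule abs_summable_summable)
qed

end

theory Submission
  imports Defs
begin

text \<open>Each clause for the composed pair is a clause for \<open>Gen\<close>, \<open>Rep\<close>
  read at image points. Output length and correctness are pointwise: \<open>f\<close> carries points
  of \<open>M1\<close> within \<open>t1\<close> to points of \<open>M2\<close> within
  \<open>t2\<close>, where the given extractor is already correct. For security, sampling
  \<open>W\<close> and running \<open>Gen\<close> on \<open>f w\<close> is the same experiment as
  running \<open>Gen\<close> on a sample of the pushforward of \<open>W\<close> under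
  \<open>f\<close>; the embedding guarantees that this pushforward has min-entropy at least
  \<open>m2\<close>, so the given bound applies with the same \<epsilon>.\<close>

theorem lemma4p6:
  fixes M1 :: "'a set" and dis1 :: "'a \<Rightarrow> 'a \<Rightarrow> real"
    and M2 :: "'b set" and dis2 :: "'b \<Rightarrow> 'b \<Rightarrow> real"
    and t1 t2 m1 m2 \<epsilon> :: real and l :: nat
    and f :: "'a \<Rightarrow> 'b"
    and Gen :: "'b \<Rightarrow> (bool list \<times> bool list) pmf"
    and Rep :: "'b \<Rightarrow> bool list \<Rightarrow> bool list pmf"
  assumes "Metric_space M1 dis1" and "finite M1"
    and "Metric_space M2 dis2" and "finite M2"
    and "biometric_embedding M1 dis1 M2 dis2 t1 t2 m1 m2 f"
    and "fuzzy_extractor M2 dis2 m2 l t2 \<epsilon> Gen Rep"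
  shows "fuzzy_extractor M1 dis1 m1 l t1 \<epsilon> (\<lambda>w. Gen (f w)) (\<lambda>w' P. Rep (f w') P)"
proof -
  have f: "f w \<in> M2" if "w \<in> M1" for w
    using assms(5) that by (auto simp: biometric_embedding_def)
  have close: "dis2 (f w) (f w') \<le> t2" if "w \<in> M1" "w' \<in> M1" "dis1 w w' \<le> t1" for w w'
    using assms(5) that by (auto simp: biometric_embedding_def)
  have entropy: "m2 \<le> min_entropy (map_pmf f W)" if "set_pmf W \<subseteq> M1" "m1 \<le> min_entropy W" for W
    using assms(5) that by (auto simp: biometric_embedding_def)
  have len: "length R = l" if "v \<in> M2" "(R, P) \<in> set_pmf (Gen v)" for v R P
    using assms(6) that by (fastforce simp: fuzzy_extractor_def)
  have correct: "pmf (Rep v' P) R = 1"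
    if "v \<in> M2" "v' \<in> M2" "dis2 v v' \<le> t2" "(R, P) \<in> set_pmf (Gen v)" for v v' R P
    using assms(6) that by (fastforce simp: fuzzy_extractor_def)
  have secure: "statistical_distance (bind_pmf V Gen)
      (pair_pmf (uniform_bits l) (map_pmf snd (bind_pmf V Gen))) \<le> \<epsilon>"
    if "set_pmf V \<subseteq> M2" "m2 \<le> min_entropy V" for V
    using assms(6) that by (simp add: fuzzy_extractor_def Let_def)
  \<comment> \<open>The key identity: it holds for the joint law of (R, P), so the marginal of P in
    the ideal distribution agrees as well.\<close>
  have bind: "bind_pmf W (\<lambda>w. Gen (f w)) = bind_pmf (map_pmf f W) Gen" for W
    by (simp add: bind_map_pmf)
  \<comment> \<open>Security over \<open>M2\<close> speaks only of distributions supported in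
    \<open>M2\<close>, so the pushforward must qualify.\<close>
  have supp: "set_pmf (map_pmf f W) \<subseteq> M2" if "set_pmf W \<subseteq> M1" for W
    using f that by auto
  show ?thesis
    \<comment> \<open>Rewriting with \<open>bind\<close> makes the security goal an exact instance
      of \<open>secure\<close>, so no error is added to \<epsilon>.\<close>
    unfolding fuzzy_extractor_def Let_def bind
  proof (intro conjI ballI allI impI; (clarify)?)
    show "length R = l" if "w \<in> M1" "(R, P) \<in> set_pmf (Gen (f w))" for w R P
      using len[OF f[OF that(1)] that(2)] .
    show "pmf (Rep (f w') P) R = 1"
      if "w \<in> M1" "w' \<in> M1" "dis1 w w' \<le> t1" "(R, P) \<in> set_pmf (Gen (f w))" for w w' R P
      using correct[OF f[OF that(1)] f[OF that(2)] close[OF that(1-3)] that(4)] .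
    show "statistical_distance (bind_pmf (map_pmf f W) Gen)
        (pair_pmf (uniform_bits l) (map_pmf snd (bind_pmf (map_pmf f W) Gen))) \<le> \<epsilon>"
      if "set_pmf W \<subseteq> M1" "m1 \<le> min_entropy W" for W
      using secure[OF supp[OF that(1)] entropy[OF that]] .
  qed
qed

end
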